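(* Let $P\subset\mathbb{R}^n$ be a convex polytope and let $\ell$ be a linear function on $\mathbb{R}^n$ that is nonconstant on every edge of $P$. Assume that for every vertex $v$ of $P$, both $F^-(v)$ and $F^+(v)$ are faces of $P$. Then the following conditions are equivalent: (1) $O^-$ is a stratification; (2) $O^+$ is a stratification; (3) for every vertex $v$, the face $F^-(v)$ has no incoming edges; (4) for every vertex $v$, the face $F^+(v)$ has no outgoing edges; (5) $\mathcal{O}=\mathcal{C}$; (6) $\mathcal{O}$ is a partial order; (7) $\mathcal{O}$ is a graded poset with grading (rank function) $\rho(v)=\dim F^-(v)$; (8) for any vertices $v,w$ of $P$, $\overline{O^+(v)\cap O^-(w)}=F^+(v)\cap F^-(w)$.
   Context: Orient each edge of $P$ from the endpoint with smaller $\ell$-value to the endpoint with larger $\ell$-value; write $v\to w$ for such a directed edge. For a vertex $v$, $O^-(v)$ (resp. $O^+(v)$) is the union of the relative interiors of all faces $G$ of $P$ such that $\ell|_G$ attains its maximum (resp. minimum) at $v$; $F^-(v)=\overline{O^-(v)}$ and $F^+(v)=\overline{O^+(v)}$ (equivalently, the union of all such faces $G$). The partitions $O^-=\{O^-(v)\}_v$ and $O^+=\{O^+(v)\}_v$ of $P$ are stratifications if $S_i\cap\overline{S_j}\ne\emptyset$ implies $S_i\subset\overline{S_j}$ for all strata. Given a face $G$, a directed edge $v_1\to v_2$ is an incoming edge of $G$ if $v_2\in G$, $v_1\notin G$, and an outgoing edge if $v_1\in G$, $v_2\notin G$. The relation $\mathcal{O}$ on vertices: $\mathcal{O}(v,w)$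 iff there is a face $G$ of $P$ on which $\ell$ attains its minimum at $v$ and its maximum at $w$. The relation $\mathcal{C}$: $\mathcal{C}(v,w)$ iff there is a chain of directed edges $v=v_0\to v_1\to\cdots\to v_k=w$ ($k\ge0$). A graded poset with rank function $\rho$ means $\rho(w)=\rho(v)+1$ whenever $w$ covers $v$. *)

theory Defs
  imports "HOL-Analysis.Analysis"
begin

definition vertices :: "'a::euclidean_space set \<Rightarrow> 'a set" where
  "vertices P = {v. v extreme_point_of P}"

definition max_at :: "('a \<Rightarrow> real) \<Rightarrow> 'a set \<Rightarrow> 'a \<Rightarrow> bool" where
  "max_at l G v \<longleftrightarrow> v \<in> G \<and> (\<forall>x\<in>G. l x \<le> l v)"

definition min_at :: "('a \<Rightarrow> real) \<Rightarrow> 'a set \<Rightarrow> 'a \<Rightarrow> bool" where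
  "min_at l G v \<longleftrightarrow> v \<in> G \<and> (\<forall>x\<in>G. l v \<le> l x)"

definition O_minus :: "'a::euclidean_space set \<Rightarrow> ('a \<Rightarrow> real) \<Rightarrow> 'a \<Rightarrow> 'a set" where
  "O_minus P l v = \<Union> {rel_interior G | G. G face_of P \<and> max_at l G v}"

definition O_plus :: "'a::euclidean_space set \<Rightarrow> ('a \<Rightarrow> real) \<Rightarrow> 'a \<Rightarrow> 'a set" where
  "O_plus P l v = \<Union> {rel_interior G | G. G face_of P \<and> min_at l G v}"

definition F_minus :: "'a::euclidean_space set \<Rightarrow> ('a \<Rightarrow> real) \<Rightarrow> 'a \<Rightarrow> 'a set" where
  "F_minus P l v = closure (O_minus P l v)"

definition F_plus :: "'a::euclidean_space set \<Rightarrow> ('a \<Rightarrow> real) \<Rightarrow> 'a \<Rightarrow> 'a set" where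
  "F_plus P l v = closure (O_plus P l v)"

definition stratification :: "'a::topological_space set \<Rightarrow> 'a set set \<Rightarrow> bool" where
  "stratification X \<S> \<longleftrightarrow> partition_on X \<S> \<and>
     (\<forall>S\<in>\<S>. \<forall>T\<in>\<S>. S \<inter> closure T \<noteq> {} \<longrightarrow> S \<subseteq> closure T)"

definition directed_edges :: "'a::euclidean_space set \<Rightarrow> ('a \<Rightarrow> real) \<Rightarrow> 'a rel" where
  "directed_edges P l = {(v, w). closed_segment v w edge_of P \<and> l v < l w}"

definition incoming_edges :: "'a::euclidean_space set \<Rightarrow> ('a \<Rightarrow> real) \<Rightarrow> 'a set \<Rightarrow> 'a rel" where
  "incoming_edges P l G = {(v, w) \<in> directed_edges P l. v \<notin> G \<and> w \<in> G}"

definition outgoing_edges :: "'a::euclidean_space set \<Rightarrow> ('a \<Rightarrow> real) \<Rightarrow> 'a set \<Rightarrow> 'a rel" where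
  "outgoing_edges P l G = {(v, w) \<in> directed_edges P l. v \<in> G \<and> w \<notin> G}"

definition face_rel :: "'a::euclidean_space set \<Rightarrow> ('a \<Rightarrow> real) \<Rightarrow> 'a rel" where
  "face_rel P l = {(v, w). v \<in> vertices P \<and> w \<in> vertices P \<and>
     (\<exists>G. G face_of P \<and> min_at l G v \<and> max_at l G w)}"

text \<open>The reflexive transitive closure relates every point of the ambient type to itself,
  so it has to be cut down to the vertices.\<close>

definition chain_rel :: "'a::euclidean_space set \<Rightarrow> ('a \<Rightarrow> real) \<Rightarrow> 'a rel" where
  "chain_rel P l = {(v, w). v \<in> vertices P \<and> w \<in> vertices P \<and> (v, w) \<in> (directed_edges P l)\<^sup>*}"

text \<open>In \<open>covered_by r v w\<close>, the pair \<open>(v, w) \<in> r\<close> means \<open>v \<le> w\<close>, and \<open>w\<close> covers \<open>v\<close>.\<close>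

definition covered_by :: "'a rel \<Rightarrow> 'a \<Rightarrow> 'a \<Rightarrow> bool" where
  "covered_by r v w \<longleftrightarrow> (v, w) \<in> r \<and> v \<noteq> w \<and>
     \<not> (\<exists>u. (v, u) \<in> r \<and> (u, w) \<in> r \<and> u \<noteq> v \<and> u \<noteq> w)"

definition graded_poset_on :: "'a set \<Rightarrow> 'a rel \<Rightarrow> ('a \<Rightarrow> int) \<Rightarrow> bool" where
  "graded_poset_on A r \<rho> \<longleftrightarrow> partial_order_on A r \<and>
     (\<forall>v\<in>A. \<forall>w\<in>A. covered_by r v w \<longrightarrow> \<rho> w = \<rho> v + 1)"

end

theory Submission
  imports Defs
begin

text \<open>
  The face \<open>F\<^sup>-(w)\<close> is the largest face with maximum \<open>w\<close>, so condition (1) says that \<open>v \<in> F\<^sup>-(w)\<close>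
  implies \<open>F\<^sup>-(v) \<subseteq> F\<^sup>-(w)\<close>. As every vertex of \<open>F\<^sup>-(w)\<close> climbs to \<open>w\<close> along edges of this face (the
  simplex method), this is (3), and then \<open>v \<in> F\<^sup>-(w)\<close> means \<open>\<C>(v,w)\<close>. On the other hand \<open>\<O>(v,w)\<close> means
  that \<open>v \<in> F\<^sup>-(w)\<close> and \<open>w \<in> F\<^sup>+(v)\<close>. The crucial point is that under (1) the first condition implies
  the second, because a face of \<open>F\<^sup>-(w)\<close> that contains all its edges at \<open>v\<close> is \<open>F\<^sup>-(w)\<close> itself. So (1)
  is equivalent to (5), which is invariant under replacing \<open>\<ell>\<close> by \<open>-\<ell>\<close>; this gives (2) and (4).
  Since \<open>\<O>\<close> contains the directed edges and is contained in \<open>\<C>\<close>, (5) also says that \<open>\<O>\<close> is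
  transitive, and (8) expresses transitivity through the face \<open>F\<^sup>+(v) \<inter> F\<^sup>-(w)\<close>.
\<close>

section \<open>Edges at a vertex of a polytope\<close>

text \<open>A face of least dimension through \<open>x\<close> works: on its relative frontier,
  \<open>x\<close> would lie in a facet, which is a smaller such face.\<close>

lemma rel_interior_face_exists:
  fixes P :: "'a::euclidean_space set"
  assumes "polytope P" "x \<in> P"
  obtains G where "G face_of P" "x \<in> rel_interior G"
proof -
  define Q where "Q = (\<lambda>G. G face_of P \<and> x \<in> G)"
  have "Q P"
    using assms by (simp add: Q_def polytope_imp_convex face_of_refl)
  then obtain G where G: "Q G" and min: "\<And>G'. Q G' \<Longrightarrow> nat (aff_dim G) \<le> nat (aff_dim G')"
    using arg_min_nat_lemma[of Q P "\<lambda>G. nat (aff_dim G)"] by blast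
  have "polyhedron G"
    using G assms(1) face_of_polytope_polytope polytope_imp_polyhedron Q_def by blast
  have "x \<in> rel_interior G"
  proof (rule ccontr)
    assume "x \<notin> rel_interior G"
    then have "x \<in> rel_frontier G"
      using G closure_subset by (auto simp: rel_frontier_def Q_def)
    then obtain F where F: "F facet_of G" "x \<in> F"
      using rel_frontier_of_polyhedron[OF \<open>polyhedron G\<close>] by auto
    then have "Q F"
      using G face_of_trans[OF facet_of_imp_face_of] by (auto simp: Q_def)
    moreover have "aff_dim F = aff_dim G - 1" "F \<noteq> {}"
      using F by (auto simp: facet_of_def)
    \<comment> \<open>Nonnegative dimension ensures that the drop from \<open>G\<close> to
      \<open>F\<close> survives the truncation by \<open>nat\<close>.\<close>
    moreover have "aff_dim F \<ge> 0"
      using \<open>F \<noteq> {}\<close> aff_dim_negative_iff[of F] by linarith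
    ultimately show False
      using min[of F] by linarith
  qed
  with G show ?thesis
    using that by (auto simp: Q_def)
qed

text \<open>Otherwise the half-space \<open>f \<le> c\<close> contains all extreme points, hence by
  Minkowski's theorem all of \<open>S\<close>.\<close>

lemma extreme_point_greater:
  fixes f :: "'a::euclidean_space \<Rightarrow> real"
  assumes "compact S" "convex S" "linear f" "x \<in> S" "c < f x"
  obtains y where "y extreme_point_of S" "c < f y"
proof (rule ccontr)
  assume "\<not> thesis"
  then have "{y. y extreme_point_of S} \<subseteq> f -` {..c}"
    using that by force
  moreover have "convex (f -` {..c})"
    using \<open>linear f\<close> by (rule convex_linear_vimage) simp
  ultimately have "S \<subseteq> f -` {..c}"
    using Krein_Milman_Minkowski[OF assms(1,2)] hull_minimal by metis
  then show False
    using assms by force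
qed

lemma edge_of_polytope_segment:
  fixes P :: "'a::euclidean_space set"
  assumes "polytope P" "e edge_of P"
  obtains a b where "e = closed_segment a b" "a extreme_point_of P" "b extreme_point_of P"
proof -
  have e: "e face_of P" "aff_dim e = 1"
    using assms by (auto simp: edge_of_def)
  then have "polytope e"
    using assms face_of_polytope_polytope by blast
  then obtain a b where ab: "e = closed_segment a b"
    using compact_convex_collinear_segment[of e] e polytope_imp_compact polytope_imp_convex
    by (metis collinear_aff_dim aff_dim_empty order_refl zero_neq_neg_one one_neq_neg_one)
  moreover have "a extreme_point_of e" "b extreme_point_of e"
    by (auto simp: ab extreme_point_of_segment)
  ultimately show ?thesis
    using that e extreme_point_of_face by blast
qed

lemma edge_of_endpoints:
  fixes v w :: "'a::euclidean_space"
  assumes "closed_segment v w edge_of P"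
  shows "v extreme_point_of P" "w extreme_point_of P"
  using assms extreme_point_of_face[of "closed_segment v w" P]
  by (auto simp: edge_of_def extreme_point_of_segment)

text \<open>The hyperplane \<open>H\<close> cuts \<open>v\<close> off from the other vertices. An extreme point of
  \<open>P \<inter> H\<close> lies in the relative interior of a face that \<open>H\<close> meets only there, so this face
  is an edge with endpoint \<open>v\<close>.\<close>

lemma exists_increasing_edge:
  fixes P :: "'a::euclidean_space set" and f :: "'a \<Rightarrow> real"
  assumes P: "polytope P" and v: "v extreme_point_of P"
    and f: "linear f" and q: "q \<in> P" "f v < f q"
  obtains w where "closed_segment v w edge_of P" "f v < f w"
proof -
  define V where "V = {x. x extreme_point_of P}"
  define K where "K = convex hull (V - {v})"
  have comp: "compact P" "convex P"
    using P polytope_imp_compact polytope_imp_convex by auto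
  have "finite V"
    unfolding V_def using P polytope_imp_polyhedron finite_polyhedron_extreme_points by blast
  then have "closed K"
    unfolding K_def by (simp add: compact_imp_closed finite_imp_compact_convex_hull)
  have "V \<subseteq> P"
    by (auto simp: V_def extreme_point_of_def)
  \<comment> \<open>Removing an extreme point preserves convexity, so \<open>v\<close> is not in the
    hull of the other vertices.\<close>
  have "convex (P - {v})"
    using v comp extreme_point_of_stillconvex by blast
  then have "K \<subseteq> P - {v}"
    unfolding K_def using \<open>V \<subseteq> P\<close> by (intro hull_minimal) auto
  then have "v \<notin> K"
    by auto
  then obtain a b where av: "a \<bullet> v < b" and aK: "\<And>x. x \<in> K \<Longrightarrow> b < a \<bullet> x"
    using separating_hyperplane_closed_point[of K v] \<open>closed K\<close> by (auto simp: K_def)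
  define H where "H = {x. a \<bullet> x = b}"
  have PH: "compact (P \<inter> H)" "convex (P \<inter> H)"
    unfolding H_def using comp
    by (auto simp: closed_hyperplane compact_Int_closed convex_Int convex_hyperplane)
  obtain q' where q': "q' \<in> V" "f v < f q'"
    using extreme_point_greater[OF comp f q] by (auto simp: V_def)
  then have "q' \<in> K"
    unfolding K_def by (intro hull_inc) auto
  \<comment> \<open>The segment from \<open>v\<close> to \<open>q'\<close> crosses \<open>H\<close>
    at parameter \<open>t\<close>; as \<open>0 < t\<close>, the crossing point still has a larger
    \<open>f\<close>-value than \<open>v\<close>.\<close>
  define t where "t = (b - a \<bullet> v) / (a \<bullet> q' - a \<bullet> v)"
  define y where "y = (1 - t) *\<^sub>R v + t *\<^sub>R q'"
  have t: "0 < t" "t < 1"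
    using av aK[OF \<open>q' \<in> K\<close>] by (auto simp: t_def)
  have "a \<bullet> y = a \<bullet> v + t * (a \<bullet> q' - a \<bullet> v)"
    by (simp add: y_def inner_add_right algebra_simps)
  also have "\<dots> = b"
    using av aK[OF \<open>q' \<in> K\<close>] by (simp add: t_def)
  finally have "y \<in> H"
    by (simp add: H_def)
  moreover have "y \<in> P"
    unfolding y_def using t q' v \<open>V \<subseteq> P\<close> comp
    by (intro convexD) (auto simp: extreme_point_of_def)
  moreover have "f v < f y"
  proof -
    have "f y = (1 - t) * f v + t * f q'"
      by (simp add: y_def linear_add[OF f] linear_scale[OF f])
    then have "f y = f v + t * (f q' - f v)"
      by (simp add: algebra_simps)
    then show ?thesis
      using t q' by simp
  qed
  ultimately obtain x where x: "x extreme_point_of (P \<inter> H)" and fx: "f v < f x"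
    using extreme_point_greater[OF PH f, of y "f v"] by auto
  then have "x \<in> P" "x \<in> H"
    by (auto simp: extreme_point_of_def)
  then obtain G where G: "G face_of P" and xG: "x \<in> rel_interior G"
    using rel_interior_face_exists[OF P] by metis
  have "G \<subseteq> P" "x \<in> G"
    using G xG face_of_imp_subset rel_interior_subset by auto
  \<comment> \<open>From a relative interior point \<open>x\<close> of \<open>G\<close> one could
    move both ways towards a second point \<open>z\<close> while staying in
    \<open>P \<inter> H\<close>, against extremality of \<open>x\<close>.\<close>
  have "affine hull G \<inter> H \<subseteq> {x}"
  proof (rule ccontr)
    assume "\<not> affine hull G \<inter> H \<subseteq> {x}"
    then obtain z where z: "z \<in> affine hull G" "z \<in> H" "z \<noteq> x"
      by auto
    obtain e where e: "e > 0" "ball x e \<inter> affine hull G \<subseteq> G"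
      using xG mem_rel_interior_ball by blast
    define s where "s = e / (2 * norm (z - x))"
    have s: "s > 0" "norm (s *\<^sub>R (z - x)) < e"
      using e z by (auto simp: s_def)
    have in_PH: "x + c *\<^sub>R (z - x) \<in> P \<inter> H" if "\<bar>c\<bar> = s" for c
    proof -
      have "x + c *\<^sub>R (z - x) = (1 - c) *\<^sub>R x + c *\<^sub>R z"
        by (simp add: algebra_simps)
      then have "x + c *\<^sub>R (z - x) \<in> affine hull G"
        using z hull_inc[OF \<open>x \<in> G\<close>, of affine] affine_affine_hull[of G]
        by (simp add: mem_affine)
      moreover have "x + c *\<^sub>R (z - x) \<in> ball x e"
        using s that by (simp add: dist_norm)
      moreover have "x + c *\<^sub>R (z - x) \<in> H"
        using z \<open>x \<in> H\<close> by (simp add: H_def inner_add_right inner_diff_right)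
      ultimately show ?thesis
        using e \<open>G \<subseteq> P\<close> by auto
    qed
    have "x = midpoint (x + s *\<^sub>R (z - x)) (x + (- s) *\<^sub>R (z - x))"
      using scaleR_half_double[of x] by (simp add: midpoint_def field_simps)
    moreover have "x + s *\<^sub>R (z - x) \<noteq> x + (- s) *\<^sub>R (z - x)"
      unfolding add_left_cancel scaleR_cancel_right using s z by auto
    ultimately have "x \<in> open_segment (x + s *\<^sub>R (z - x)) (x + (- s) *\<^sub>R (z - x))"
      using midpoint_in_open_segment by metis
    then show False
      using x in_PH[of s] in_PH[of "- s"] s by (auto simp: extreme_point_of_def)
  qed
  then have "affine hull G \<inter> H = {x}"
    using \<open>x \<in> H\<close> \<open>x \<in> G\<close> by (auto intro: hull_inc)
  \<comment> \<open>A hyperplane section lowers the dimension of an affine set it meets by at most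
    one, and here the section is a point.\<close>
  then have "aff_dim G \<le> 1"
    using aff_dim_affine_Int_hyperplane[OF affine_affine_hull, of G a b]
    by (auto simp: H_def split: if_splits)
  \<comment> \<open>No vertex lies on \<open>H\<close>: \<open>v\<close> is strictly below it and
    the other vertices are strictly above.\<close>
  moreover have "aff_dim G \<noteq> 0"
  proof
    assume "aff_dim G = 0"
    then have "G = {x}"
      using \<open>x \<in> G\<close> by (auto simp: aff_dim_eq_0)
    then have "x \<in> V"
      using G by (simp add: face_of_singleton V_def)
    then have "x = v \<or> x \<in> K"
      unfolding K_def by (auto intro: hull_inc)
    then show False
      using av aK \<open>x \<in> H\<close> by (auto simp: H_def)
  qed
  moreover have "aff_dim G \<ge> 0"
    using \<open>x \<in> G\<close> aff_dim_negative_iff[of G] by (metis empty_iff linorder_not_less)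
  ultimately have "G edge_of P"
    using G by (simp add: edge_of_def)
  then obtain c d where cd: "G = closed_segment c d" "c \<in> V" "d \<in> V"
    using edge_of_polytope_segment[OF P] by (auto simp: V_def)
  have "v \<in> {c, d}"
  proof (rule ccontr)
    assume "v \<notin> {c, d}"
    then have "c \<in> K" "d \<in> K"
      unfolding K_def using cd by (auto intro: hull_inc)
    then have "G \<subseteq> K"
      unfolding cd K_def by (simp add: closed_segment_subset)
    then show False
      using aK[of x] \<open>x \<in> G\<close> \<open>x \<in> H\<close> by (auto simp: H_def)
  qed
  then obtain w where w: "G = closed_segment v w"
    using cd by (auto simp: closed_segment_commute)
  obtain u where u: "0 \<le> u" "x = (1 - u) *\<^sub>R v + u *\<^sub>R w"
    using \<open>x \<in> G\<close> w by (auto simp: in_segment)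
  have "f x = (1 - u) * f v + u * f w"
    unfolding u by (simp add: linear_add[OF f] linear_scale[OF f])
  then have "f x = f v + u * (f w - f v)"
    by (simp add: algebra_simps)
  then have "f v < f w"
    using fx u by (smt (verit) mult_nonneg_nonpos)
  with \<open>G edge_of P\<close> w show ?thesis
    using that by blast
qed

text \<open>The edges at a vertex affinely span the polytope. A functional separating
  \<open>A\<close> from a point of \<open>P\<close> would decrease along some edge at
  \<open>v\<close>, yet the line of this edge lies in \<open>A\<close>, where the functional is
  bounded below.\<close>

lemma polytope_subset_affine:
  fixes P :: "'a::euclidean_space set"
  assumes P: "polytope P" and v: "v extreme_point_of P" and A: "affine A" "v \<in> A"
    and edges: "\<And>w. closed_segment v w edge_of P \<Longrightarrow> w \<in> A"
  shows "P \<subseteq> A"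
proof
  fix q assume q: "q \<in> P"
  show "q \<in> A"
  proof (rule ccontr)
    assume "q \<notin> A"
    then obtain a b where ab: "a \<bullet> q < b" "\<And>x. x \<in> A \<Longrightarrow> b < a \<bullet> x"
      using separating_hyperplane_closed_point[of A q] A affine_imp_convex[OF A(1)] affine_closed[OF A(1)] by blast
    have "linear (\<lambda>x. - (a \<bullet> x))"
      by (simp add: linear_iff inner_add_right)
    then obtain w where w: "closed_segment v w edge_of P" "a \<bullet> w < a \<bullet> v"
      using exists_increasing_edge[OF P v _ q, of "\<lambda>x. - (a \<bullet> x)"] ab A by force
    \<comment> \<open>The point of the line at height \<open>b\<close>. It lies beyond
      \<open>w\<close>, which is why \<open>A\<close> has to be affine and not merely
      convex.\<close>
    define t where "t = (a \<bullet> v - b) / (a \<bullet> v - a \<bullet> w)"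
    have "(1 - t) *\<^sub>R v + t *\<^sub>R w \<in> A"
      using A edges w by (simp add: mem_affine)
    moreover have "a \<bullet> ((1 - t) *\<^sub>R v + t *\<^sub>R w) = a \<bullet> v - t * (a \<bullet> v - a \<bullet> w)"
      by (simp add: inner_add_right algebra_simps)
    moreover have "\<dots> = b"
      using w by (simp add: t_def)
    ultimately show False
      using ab(2) by force
  qed
qed

section \<open>Linear functions in general position on a polytope\<close>

locale generic_polytope =
  fixes P :: "'a::euclidean_space set" and l :: "'a \<Rightarrow> real"
  assumes polytope_P: "polytope P"
    and linear_l: "linear l"
    and edge_nonconstant: "\<And>e. e edge_of P \<Longrightarrow> \<not> l constant_on e"
begin

lemma face_polytope: "G face_of P \<Longrightarrow> polytope G"
  using polytope_P face_of_polytope_polytope by blast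

lemma face_closed_convex: "G face_of P \<Longrightarrow> closed G" "G face_of P \<Longrightarrow> convex G"
  using face_polytope polytope_imp_closed polytope_imp_convex by blast+

section \<open>Maxima of \<open>l\<close> on faces\<close>

text \<open>Written as an inner product, \<open>l\<close> has a supporting hyperplane of
  \<open>G\<close> as its level set at the maximum, and a face of a face is a face.\<close>

lemma max_at_face:
  assumes G: "G face_of P" and v: "max_at l G v"
  shows "G \<inter> {x. l x = l v} face_of P"
proof -
  obtain a where a: "\<And>x. l x = a \<bullet> x"
    using adjoint_works[OF linear_l, of _ 1] by (metis inner_commute inner_real_def mult.right_neutral)
  have "G \<inter> {x. a \<bullet> x = a \<bullet> v} face_of G"
    using face_closed_convex[OF G] v
    by (intro face_of_Int_supporting_hyperplane_le) (auto simp: max_at_def a)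
  then show ?thesis
    using G face_of_trans by (auto simp: a)
qed

text \<open>The points of \<open>G\<close> with maximal value form a face; with two points it would
  have an edge, on which \<open>l\<close> is constant.\<close>

lemma max_at_unique:
  assumes G: "G face_of P" and v: "max_at l G v" and w: "max_at l G w"
  shows "v = w"
proof (rule ccontr)
  assume "v \<noteq> w"
  define M where "M = G \<inter> {x. l x = l v}"
  have M: "M face_of P"
    unfolding M_def using max_at_face G v .
  have vw: "v \<in> M" "w \<in> M"
    using v w by (auto simp: M_def max_at_def intro: antisym)
  have comp: "compact M" "convex M"
    using face_polytope[OF M] polytope_imp_compact polytope_imp_convex by auto
  obtain p where p: "p extreme_point_of M"
    using extreme_point_exists_convex[of M] vw comp by auto
  obtain q where q: "q \<in> M" "q \<noteq> p"
    using vw \<open>v \<noteq> w\<close> by metis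
  \<comment> \<open>Any linear function with a larger value at \<open>q\<close> than at
    \<open>p\<close> yields an edge at \<open>p\<close>.\<close>
  have "linear (\<lambda>x. (q - p) \<bullet> x)"
    by (simp add: linear_iff inner_add_right)
  moreover have "(q - p) \<bullet> p < (q - p) \<bullet> q"
    using q inner_gt_zero_iff[of "q - p"] by (simp add: inner_diff_right)
  ultimately obtain e where "closed_segment p e edge_of M"
    using exists_increasing_edge[OF face_polytope[OF M] p _ q(1)] by metis
  then have "closed_segment p e edge_of P" "closed_segment p e \<subseteq> M"
    using M face_of_trans[OF _ M] edge_of_imp_subset by (simp_all add: edge_of_def)
  moreover have "l constant_on M"
    by (auto simp: constant_on_def M_def)
  ultimately show False
    using edge_nonconstant constant_on_subset by blast
qed

text \<open>A maximum exists by compactness; being unique, it is a face by itself, hence a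
  vertex.\<close>

lemma max_at_exists:
  assumes G: "G face_of P" and "G \<noteq> {}"
  obtains v where "v \<in> vertices P" "max_at l G v"
proof -
  have "compact G"
    using face_polytope[OF G] polytope_imp_compact by auto
  moreover have "continuous_on G l"
    using linear_l linear_continuous_on linear_conv_bounded_linear by blast
  ultimately obtain x where x: "max_at l G x"
    using continuous_attains_sup[of G l] \<open>G \<noteq> {}\<close> by (auto simp: max_at_def)
  have "y = x" if "y \<in> G" "l y = l x" for y
    using x that by (intro max_at_unique[OF G _ x]) (simp add: max_at_def)
  then have "G \<inter> {y. l y = l x} = {x}"
    using x by (auto simp: max_at_def)
  then have "x extreme_point_of P"
    using max_at_face[OF G x] by (simp add: face_of_singleton)
  with x show ?thesis
    using that by (auto simp: vertices_def)
qed

lemma max_at_vertex: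
  assumes "G face_of P" "max_at l G v"
  shows "v \<in> vertices P"
  using assms max_at_exists max_at_unique by (metis empty_iff max_at_def)

lemma max_at_strict:
  assumes "G face_of P" "max_at l G v" "x \<in> G" "x \<noteq> v"
  shows "l x < l v"
  using assms max_at_unique by (fastforce simp: max_at_def)

lemma vertex_face: "v \<in> vertices P \<Longrightarrow> {v} face_of P"
  by (simp add: vertices_def face_of_singleton)

section \<open>The cells \<open>O_minus\<close> and their closures\<close>

lemma mem_O_minus: "v \<in> vertices P \<Longrightarrow> v \<in> O_minus P l v"
  unfolding O_minus_def using vertex_face
  by (auto simp: max_at_def intro!: exI[of _ "{v}"])

lemma O_minus_subset_F_minus: "O_minus P l v \<subseteq> F_minus P l v"
  unfolding F_minus_def by (rule closure_subset)

lemma mem_F_minus: "v \<in> vertices P \<Longrightarrow> v \<in> F_minus P l v"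
  using mem_O_minus O_minus_subset_F_minus by blast

lemma max_at_imp_subset_F_minus:
  assumes "G face_of P" "max_at l G v"
  shows "G \<subseteq> F_minus P l v"
proof -
  have "closure (rel_interior G) = G"
    using face_closed_convex[OF assms(1)] by (simp add: convex_closure_rel_interior)
  moreover have "rel_interior G \<subseteq> O_minus P l v"
    using assms by (auto simp: O_minus_def)
  ultimately show ?thesis
    unfolding F_minus_def by (metis closure_mono)
qed

text \<open>The closed half-space \<open>l x \<le> l v\<close> contains the cell, hence its closure.
  Thus \<open>F_minus P l v\<close>, when it is a face, is the largest one with maximum
  \<open>v\<close>.\<close>

lemma max_at_F_minus:
  assumes "v \<in> vertices P"
  shows "max_at l (F_minus P l v) v"
proof -
  have "O_minus P l v \<subseteq> {x. l x \<le> l v}"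
    using rel_interior_subset by (fastforce simp: O_minus_def max_at_def)
  moreover have "closed {x. l x \<le> l v}"
    using linear_l by (intro closed_Collect_le continuous_intros linear_continuous_on)
      (simp add: linear_conv_bounded_linear)
  ultimately have "F_minus P l v \<subseteq> {x. l x \<le> l v}"
    unfolding F_minus_def by (rule closure_minimal)
  then show ?thesis
    using mem_F_minus[OF assms] by (auto simp: max_at_def)
qed

text \<open>Every point lies in the relative interior of exactly one face, and every nonempty face
  has exactly one maximum, a vertex.\<close>

lemma partition_O_minus: "partition_on P (O_minus P l ` vertices P)"
proof (rule partition_onI)
  show "\<Union> (O_minus P l ` vertices P) = P"
  proof (intro equalityI subsetI)
    fix x assume "x \<in> \<Union> (O_minus P l ` vertices P)"
    then show "x \<in> P"
      using rel_interior_subset face_of_imp_subset by (fastforce simp: O_minus_def)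
  next
    fix x assume "x \<in> P"
    then obtain G where G: "G face_of P" "x \<in> rel_interior G"
      using rel_interior_face_exists[OF polytope_P] by metis
    then obtain v where "v \<in> vertices P" "max_at l G v"
      using max_at_exists rel_interior_subset by blast
    with G show "x \<in> \<Union> (O_minus P l ` vertices P)"
      by (auto simp: O_minus_def)
  qed
next
  fix S T assume ST: "S \<in> O_minus P l ` vertices P" "T \<in> O_minus P l ` vertices P" "S \<noteq> T"
  then obtain v w where vw: "S = O_minus P l v" "T = O_minus P l w" "v \<noteq> w"
    by auto
  show "disjnt S T"
  proof (rule ccontr)
    assume "\<not> disjnt S T"
    then obtain x G G' where "x \<in> rel_interior G" "G face_of P" "max_at l G v"
      "x \<in> rel_interior G'" "G' face_of P" "max_at l G' w"
      unfolding vw by (auto simp: disjnt_iff O_minus_def)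
    then show False
      using face_of_eq[of G P G'] max_at_unique vw by blast
  qed
next
  show "{} \<notin> O_minus P l ` vertices P"
    using mem_O_minus by force
qed

lemma finite_vertices: "finite (vertices P)"
  unfolding vertices_def
  using polytope_P polytope_imp_polyhedron finite_polyhedron_extreme_points by blast

section \<open>Directed edges and increasing chains\<close>

lemma directed_edges_vertices:
  assumes "(v, w) \<in> directed_edges P l"
  shows "v \<in> vertices P" "w \<in> vertices P"
  using assms edge_of_endpoints by (auto simp: directed_edges_def vertices_def)

lemma directed_edge_max_at:
  assumes "(v, w) \<in> directed_edges P l"
  shows "max_at l (closed_segment v w) w"
  unfolding max_at_def
proof (intro conjI ballI)
  fix x assume "x \<in> closed_segment v w"
  then obtain u where u: "0 \<le> u" "u \<le> 1" "x = (1 - u) *\<^sub>R v + u *\<^sub>R w"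
    by (auto simp: in_segment)
  have "l x = (1 - u) * l v + u * l w"
    unfolding u by (simp add: linear_add[OF linear_l] linear_scale[OF linear_l])
  also have "\<dots> \<le> (1 - u) * l w + u * l w"
    using assms u by (intro add_mono mult_left_mono) (auto simp: directed_edges_def)
  finally show "l x \<le> l w"
    by (simp add: algebra_simps)
qed simp

lemma directed_edge_subset_F_minus:
  assumes "(v, w) \<in> directed_edges P l"
  shows "closed_segment v w \<subseteq> F_minus P l w"
  using directed_edge_max_at[OF assms] assms
  by (intro max_at_imp_subset_F_minus) (auto simp: directed_edges_def edge_of_def)

lemma chain_less:
  assumes "(v, w) \<in> (directed_edges P l)\<^sup>*"
  shows "v = w \<or> l v < l w"
  using assms by induction (auto simp: directed_edges_def)

text \<open>An edge of a face is an edge of \<open>P\<close>; equal values at its ends would make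
  \<open>l\<close> constant on it, so it is directed one way or the other.\<close>

lemma directed_edge_in_face:
  assumes G: "G face_of P" and "v \<in> vertices P" "v \<in> G" and e: "closed_segment v w edge_of G"
  shows "closed_segment v w edge_of P" "w \<in> G" "w \<in> vertices P"
    "(v, w) \<in> directed_edges P l \<or> (w, v) \<in> directed_edges P l"
proof -
  show *: "closed_segment v w edge_of P"
    using e face_of_trans[OF _ G] by (simp add: edge_of_def)
  show "w \<in> G"
    using edge_of_imp_subset[OF e] by auto
  show "w \<in> vertices P"
    using edge_of_endpoints[OF *] by (simp add: vertices_def)
  have "l v \<noteq> l w"
  proof
    assume eq: "l v = l w"
    have "l x = l w" if x: "x \<in> closed_segment v w" for x
    proof -
      obtain u where u: "x = (1 - u) *\<^sub>R v + u *\<^sub>R w"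
        using x by (auto simp: in_segment)
      have "l x = (1 - u) * l v + u * l w"
        unfolding u by (simp add: linear_add[OF linear_l] linear_scale[OF linear_l])
      then show ?thesis
        by (simp add: eq algebra_simps)
    qed
    then have "l constant_on closed_segment v w"
      unfolding constant_on_def by blast
    then show False
      using edge_nonconstant * by blast
  qed
  with * show "(v, w) \<in> directed_edges P l \<or> (w, v) \<in> directed_edges P l"
    by (auto simp: directed_edges_def closed_segment_commute)
qed

lemma increasing_edge_in_face:
  assumes G: "G face_of P" "max_at l G m" and v: "v \<in> vertices P" "v \<in> G" "v \<noteq> m"
  obtains w where "(v, w) \<in> directed_edges P l" "w \<in> G"
proof -
  have "v extreme_point_of G"
    using v G extreme_point_of_face by (auto simp: vertices_def)
  moreover have "m \<in> G" "l v < l m"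
    using G v max_at_strict by (auto simp: max_at_def)
  ultimately obtain w where w: "closed_segment v w edge_of G" "l v < l w"
    using exists_increasing_edge face_polytope[OF G(1)] linear_l by metis
  then show ?thesis
    using that directed_edge_in_face[OF G(1) v(1,2) w(1)] by (auto simp: directed_edges_def)
qed

lemma chain_to_max:
  assumes G: "G face_of P" "max_at l G m" and v: "v \<in> vertices P" "v \<in> G"
  shows "(v, m) \<in> (directed_edges P l)\<^sup>*"
  using v
\<comment> \<open>Each increasing edge inside \<open>G\<close> leaves strictly fewer vertices above
  the current one, so the climb stops, and it can only stop at \<open>m\<close>.\<close>
proof (induction "card {x \<in> vertices P. l v < l x}" arbitrary: v rule: less_induct)
  case less
  show ?case
  proof (cases "v = m")
    case False
    then obtain w where w: "(v, w) \<in> directed_edges P l" "w \<in> G"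
      using increasing_edge_in_face G less.prems by metis
    then have "w \<in> vertices P" "l v < l w"
      using directed_edges_vertices by (auto simp: directed_edges_def)
    then have "{x \<in> vertices P. l w < l x} \<subset> {x \<in> vertices P. l v < l x}"
      by auto
    then have "card {x \<in> vertices P. l w < l x} < card {x \<in> vertices P. l v < l x}"
      using finite_vertices by (intro psubset_card_mono) auto
    then have "(w, m) \<in> (directed_edges P l)\<^sup>*"
      using less.hyps w \<open>w \<in> vertices P\<close> by blast
    with w show ?thesis
      by (meson converse_rtrancl_into_rtrancl)
  qed simp
qed

lemma face_rel_subset_chain_rel: "face_rel P l \<subseteq> chain_rel P l"
  using chain_to_max by (auto simp: face_rel_def chain_rel_def min_at_def)

end

section \<open>Exchange of minus and plus by negating \<open>l\<close>\<close>

lemma min_at_uminus: "min_at l G v \<longleftrightarrow> max_at (\<lambda>x. - l x) G v"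
  by (simp add: min_at_def max_at_def)

lemma O_plus_uminus: "O_plus P l = O_minus P (\<lambda>x. - l x)"
  by (simp add: fun_eq_iff O_plus_def O_minus_def min_at_uminus)

lemma F_plus_uminus: "F_plus P l = F_minus P (\<lambda>x. - l x)"
  by (simp add: fun_eq_iff F_plus_def F_minus_def O_plus_uminus)

lemma directed_edges_uminus: "directed_edges P (\<lambda>x. - l x) = (directed_edges P l)\<inverse>"
  by (auto simp: directed_edges_def closed_segment_commute)

lemma outgoing_edges_uminus: "outgoing_edges P l G = (incoming_edges P (\<lambda>x. - l x) G)\<inverse>"
  by (auto simp: outgoing_edges_def incoming_edges_def directed_edges_uminus)

lemma face_rel_uminus: "face_rel P (\<lambda>x. - l x) = (face_rel P l)\<inverse>"
  by (auto simp: face_rel_def max_at_def min_at_def)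

lemma chain_rel_uminus: "chain_rel P (\<lambda>x. - l x) = (chain_rel P l)\<inverse>"
  by (auto simp: chain_rel_def directed_edges_uminus rtrancl_converse)

lemma (in generic_polytope) generic_polytope_uminus: "generic_polytope P (\<lambda>x. - l x)"
proof (rule generic_polytope.intro)
  show "linear (\<lambda>x. - l x)"
    using linear_l by (rule linear_compose_neg)
  show "\<not> (\<lambda>x. - l x) constant_on e" if "e edge_of P" for e
    using edge_nonconstant[OF that] unfolding constant_on_def by (metis minus_equation_iff)
qed (rule polytope_P)

lemma (in generic_polytope) face_rel_min_max:
  assumes "G face_of P" "min_at l G v" "max_at l G w"
  shows "(v, w) \<in> face_rel P l"
proof -
  interpret neg: generic_polytope P "\<lambda>x. - l x"
    by (rule generic_polytope_uminus)
  have "v \<in> vertices P" "w \<in> vertices P"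
    using assms max_at_vertex neg.max_at_vertex by (auto simp: min_at_uminus)
  with assms show ?thesis
    by (auto simp: face_rel_def)
qed

section \<open>Strata and incoming edges\<close>

locale generic_polytope_faces = generic_polytope +
  assumes F_minus_face: "\<And>v. v \<in> vertices P \<Longrightarrow> F_minus P l v face_of P"
    and F_plus_face: "\<And>v. v \<in> vertices P \<Longrightarrow> F_plus P l v face_of P"
begin

lemma generic_polytope_faces_uminus: "generic_polytope_faces P (\<lambda>x. - l x)"
proof -
  interpret neg: generic_polytope P "\<lambda>x. - l x"
    by (rule generic_polytope_uminus)
  show ?thesis
    \<comment> \<open>At \<open>- l\<close> the rule cancels a double negation:
      \<open>F_plus\<close> for \<open>- l\<close> is \<open>F_minus\<close> for
      \<open>l\<close>.\<close>
    by unfold_locales (simp_all add: F_minus_face F_plus_face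
        F_plus_uminus[of P "\<lambda>x. - l x"] flip: F_plus_uminus)
qed

text \<open>A face whose relative interior meets \<open>F_minus P l v\<close> is contained in it,
  together with its maximum \<open>w\<close>.\<close>

lemma O_minus_meets_F_minus_iff:
  assumes "v \<in> vertices P" "w \<in> vertices P"
  shows "O_minus P l w \<inter> F_minus P l v \<noteq> {} \<longleftrightarrow> w \<in> F_minus P l v"
proof
  assume "O_minus P l w \<inter> F_minus P l v \<noteq> {}"
  then obtain x G where G: "G face_of P" "max_at l G w" "x \<in> rel_interior G" "x \<in> F_minus P l v"
    by (auto simp: O_minus_def)
  then have "G \<subseteq> F_minus P l v"
    using subset_of_face_of[OF F_minus_face, of v G] assms face_of_imp_subset by blast
  then show "w \<in> F_minus P l v"
    using G by (auto simp: max_at_def)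
qed (use mem_O_minus assms in blast)

lemma stratification_iff_F_minus_mono:
  "stratification P (O_minus P l ` vertices P) \<longleftrightarrow>
     (\<forall>v\<in>vertices P. \<forall>w\<in>vertices P. w \<in> F_minus P l v \<longrightarrow> F_minus P l w \<subseteq> F_minus P l v)"
proof -
  have "O_minus P l w \<subseteq> F_minus P l v \<longleftrightarrow> F_minus P l w \<subseteq> F_minus P l v" for v w
    unfolding F_minus_def by (metis closed_closure closure_minimal closure_subset subset_trans)
  then show ?thesis
    unfolding stratification_def
    using partition_O_minus O_minus_meets_F_minus_iff by (simp flip: F_minus_def) blast
qed

text \<open>A face is the convex hull of its vertices, and \<open>F_minus P l v\<close> is
  convex.\<close>

lemma face_subset_of_F_minus:
  assumes "v \<in> vertices P" "G face_of P" "\<And>x. x \<in> vertices P \<Longrightarrow> x \<in> G \<Longrightarrow> x \<in> F_minus P l v"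
  shows "G \<subseteq> F_minus P l v"
proof -
  have "{x. x extreme_point_of G} \<subseteq> F_minus P l v"
    using assms extreme_point_of_face by (auto simp: vertices_def)
  then have "convex hull {x. x extreme_point_of G} \<subseteq> F_minus P l v"
    using F_minus_face[OF assms(1)] face_closed_convex by (intro hull_minimal) auto
  then show ?thesis
    using Krein_Milman_Minkowski[of G] face_polytope[OF assms(2)]
      polytope_imp_compact polytope_imp_convex by metis
qed

lemma chain_closed:
  assumes "incoming_edges P l F = {}" "(u, w) \<in> (directed_edges P l)\<^sup>*" "w \<in> F"
  shows "u \<in> F"
  using assms(2,3,1) by (induction rule: converse_rtrancl_induct) (auto simp: incoming_edges_def)

text \<open>An edge ending at \<open>w\<close> lies in \<open>F_minus P l w\<close>, so monotonicity
  excludes incoming edges. Conversely, every vertex of \<open>F_minus P l w\<close> climbs to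
  \<open>w\<close>, and without incoming edges the chain cannot start outside
  \<open>F_minus P l v\<close>.\<close>

lemma stratification_iff_incoming:
  "stratification P (O_minus P l ` vertices P) \<longleftrightarrow>
     (\<forall>v\<in>vertices P. incoming_edges P l (F_minus P l v) = {})"
  unfolding stratification_iff_F_minus_mono
proof (intro iffI ballI impI)
  fix v
  assume mono: "\<forall>v\<in>vertices P. \<forall>w\<in>vertices P. w \<in> F_minus P l v \<longrightarrow> F_minus P l w \<subseteq> F_minus P l v"
    and v: "v \<in> vertices P"
  have "u \<in> F_minus P l v" if "(u, w) \<in> directed_edges P l" "w \<in> F_minus P l v" for u w
    using directed_edge_subset_F_minus[OF that(1)] mono v directed_edges_vertices[OF that(1)] that
    by force
  then show "incoming_edges P l (F_minus P l v) = {}"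
    by (auto simp: incoming_edges_def)
next
  fix v w
  assume inc: "\<forall>v\<in>vertices P. incoming_edges P l (F_minus P l v) = {}"
    and vw: "v \<in> vertices P" "w \<in> vertices P" "w \<in> F_minus P l v"
  show "F_minus P l w \<subseteq> F_minus P l v"
    using vw(1) F_minus_face[OF vw(2)]
  proof (rule face_subset_of_F_minus)
    fix x assume "x \<in> vertices P" "x \<in> F_minus P l w"
    then have "(x, w) \<in> (directed_edges P l)\<^sup>*"
      using chain_to_max F_minus_face max_at_F_minus vw by blast
    then show "x \<in> F_minus P l v"
      using chain_closed inc vw by blast
  qed
qed

lemma directed_edge_subset_F_plus:
  assumes "(v, w) \<in> directed_edges P l"
  shows "closed_segment v w \<subseteq> F_plus P l v"
proof -
  interpret neg: generic_polytope P "\<lambda>x. - l x"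
    by (rule generic_polytope_uminus)
  show ?thesis
    using neg.directed_edge_subset_F_minus[of w v] assms
    by (simp add: directed_edges_uminus F_plus_uminus closed_segment_commute)
qed

lemma min_at_F_plus: "v \<in> vertices P \<Longrightarrow> min_at l (F_plus P l v) v"
  using generic_polytope.max_at_F_minus[OF generic_polytope_uminus]
  by (simp add: min_at_uminus F_plus_uminus)

lemma min_at_imp_subset_F_plus: "G face_of P \<Longrightarrow> min_at l G v \<Longrightarrow> G \<subseteq> F_plus P l v"
  using generic_polytope.max_at_imp_subset_F_minus[OF generic_polytope_uminus]
  by (simp add: min_at_uminus F_plus_uminus)

text \<open>By maximality of both faces, a witness exists exactly when
  \<open>F_plus P l v \<inter> F_minus P l w\<close> is one.\<close>

lemma face_rel_iff:
  assumes "v \<in> vertices P" "w \<in> vertices P"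
  shows "(v, w) \<in> face_rel P l \<longleftrightarrow> v \<in> F_minus P l w \<and> w \<in> F_plus P l v"
proof
  assume "(v, w) \<in> face_rel P l"
  then obtain G where "G face_of P" "min_at l G v" "max_at l G w"
    by (auto simp: face_rel_def)
  then show "v \<in> F_minus P l w \<and> w \<in> F_plus P l v"
    using max_at_imp_subset_F_minus[of G w] min_at_imp_subset_F_plus[of G v]
    by (auto simp: max_at_def min_at_def)
next
  assume vw: "v \<in> F_minus P l w \<and> w \<in> F_plus P l v"
  define G where "G = F_plus P l v \<inter> F_minus P l w"
  have "G face_of P"
    unfolding G_def using assms F_minus_face F_plus_face by (intro face_of_Int) auto
  moreover have "min_at l G v" "max_at l G w"
    using vw min_at_F_plus[OF assms(1)] max_at_F_minus[OF assms(2)]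
    by (auto simp: G_def min_at_def max_at_def)
  ultimately show "(v, w) \<in> face_rel P l"
    using assms by (auto simp: face_rel_def)
qed

section \<open>Closure relations between the faces\<close>

text \<open>The edges at \<open>v\<close> put \<open>Q\<close> into the affine hull of
  \<open>K\<close>, and this hull meets \<open>P\<close> only in \<open>K\<close>.\<close>

lemma face_subset_face_of_edges:
  assumes Q: "Q face_of P" and K: "K face_of P" and v: "v \<in> vertices P" "v \<in> Q" "v \<in> K"
    and edges: "\<And>u. closed_segment v u edge_of Q \<Longrightarrow> u \<in> K"
  shows "Q \<subseteq> K"
proof -
  have "v extreme_point_of Q"
    using v Q extreme_point_of_face by (auto simp: vertices_def)
  then have "Q \<subseteq> affine hull K"
    using face_polytope[OF Q] v edges
    by (intro polytope_subset_affine[of Q v]) (auto intro: hull_inc)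
  moreover have "K = affine hull K \<inter> P"
    using face_of_imp_eq_affine_Int K polytope_P polytope_imp_convex by blast
  ultimately show ?thesis
    using face_of_imp_subset[OF Q] by auto
qed

text \<open>Let \<open>w'\<close> be the maximum of \<open>F\<^sup>+(v) \<inter> F\<^sup>-(w)\<close>. The face \<open>F\<^sup>-(w')\<close> contains every edge of
  \<open>F\<^sup>-(w)\<close> at \<open>v\<close>: the outgoing ones because they lie in \<open>F\<^sup>+(v)\<close>, the incoming ones because
  they lie in \<open>F\<^sup>-(v)\<close>. Hence it contains \<open>F\<^sup>-(w)\<close>, and \<open>w' = w\<close>.\<close>

lemma F_minus_imp_F_plus:
  assumes strat: "stratification P (O_minus P l ` vertices P)"
    and v: "v \<in> vertices P" and w: "w \<in> vertices P" and vw: "v \<in> F_minus P l w"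
  shows "w \<in> F_plus P l v"
proof -
  define E where "E = F_plus P l v \<inter> F_minus P l w"
  have E: "E face_of P"
    unfolding E_def using v w F_minus_face F_plus_face by (intro face_of_Int) auto
  have "v \<in> E"
    using vw min_at_F_plus[OF v] by (simp add: E_def min_at_def)
  then obtain w' where w': "w' \<in> vertices P" "max_at l E w'"
    using max_at_exists[OF E] by blast
  have "E \<subseteq> F_minus P l w'"
    using E w' max_at_imp_subset_F_minus by blast
  then have "v \<in> F_minus P l w'"
    using \<open>v \<in> E\<close> by blast
  then have "F_minus P l v \<subseteq> F_minus P l w'"
    using strat v w' by (simp add: stratification_iff_F_minus_mono)
  have "F_minus P l w \<subseteq> F_minus P l w'"
  proof (rule face_subset_face_of_edges[OF F_minus_face[OF w] F_minus_face[OF w'(1)] v vw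
        \<open>v \<in> F_minus P l w'\<close>])
    fix u assume u: "closed_segment v u edge_of F_minus P l w"
    note edge = directed_edge_in_face[OF F_minus_face[OF w] v vw u]
    from edge(4) show "u \<in> F_minus P l w'"
    proof
      assume "(v, u) \<in> directed_edges P l"
      then show ?thesis
        using directed_edge_subset_F_plus[of v u] edge(2) \<open>E \<subseteq> F_minus P l w'\<close>
        by (auto simp: E_def)
    next
      assume "(u, v) \<in> directed_edges P l"
      then show ?thesis
        using directed_edge_subset_F_minus[of u v] \<open>F_minus P l v \<subseteq> F_minus P l w'\<close> by auto
    qed
  qed
  then have "w \<in> F_minus P l w'"
    using mem_F_minus[OF w] by blast
  then have "l w \<le> l w'"
    using max_at_F_minus[OF w'(1)] by (simp add: max_at_def)
  moreover have "w' \<in> E"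
    using w' by (simp add: max_at_def)
  ultimately have "w' = w"
    using max_at_strict[OF F_minus_face[OF w] max_at_F_minus[OF w], of w']
    by (force simp: E_def)
  with \<open>w' \<in> E\<close> show ?thesis
    by (simp add: E_def)
qed

lemma stratification_chain_rel_iff:
  assumes strat: "stratification P (O_minus P l ` vertices P)"
    and v: "v \<in> vertices P" and w: "w \<in> vertices P"
  shows "(v, w) \<in> chain_rel P l \<longleftrightarrow> v \<in> F_minus P l w"
proof
  assume "(v, w) \<in> chain_rel P l"
  then show "v \<in> F_minus P l w"
    using chain_closed strat w mem_F_minus[OF w]
    by (auto simp: stratification_iff_incoming chain_rel_def)
next
  assume "v \<in> F_minus P l w"
  then show "(v, w) \<in> chain_rel P l"
    using chain_to_max[OF F_minus_face[OF w] max_at_F_minus[OF w] v] v w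
    by (simp add: chain_rel_def)
qed

lemma stratification_imp_face_rel_eq:
  assumes strat: "stratification P (O_minus P l ` vertices P)"
  shows "face_rel P l = chain_rel P l"
proof -
  have "(v, w) \<in> face_rel P l \<longleftrightarrow> (v, w) \<in> chain_rel P l" if "v \<in> vertices P" "w \<in> vertices P" for v w
    using that strat face_rel_iff F_minus_imp_F_plus stratification_chain_rel_iff by blast
  moreover have "v \<in> vertices P \<and> w \<in> vertices P"
    if "(v, w) \<in> face_rel P l \<or> (v, w) \<in> chain_rel P l" for v w
    using that by (auto simp: face_rel_def chain_rel_def)
  ultimately show ?thesis
    by (intro set_eqI) (metis surj_pair)
qed

text \<open>An edge into \<open>F_minus P l v\<close> extends to a chain up to \<open>v\<close>;
  once chains come from faces, its start lies in \<open>F_minus P l v\<close> too.\<close>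

lemma face_rel_eq_imp_incoming:
  assumes eq: "face_rel P l = chain_rel P l" and v: "v \<in> vertices P"
  shows "incoming_edges P l (F_minus P l v) = {}"
proof -
  have "u \<in> F_minus P l v" if uw: "(u, w) \<in> directed_edges P l" and w: "w \<in> F_minus P l v" for u w
  proof -
    have V: "u \<in> vertices P" "w \<in> vertices P"
      using directed_edges_vertices[OF uw] by auto
    then have "(w, v) \<in> (directed_edges P l)\<^sup>*"
      using chain_to_max F_minus_face[OF v] max_at_F_minus[OF v] w by blast
    then have "(u, v) \<in> chain_rel P l"
      using uw V v by (auto simp: chain_rel_def intro: converse_rtrancl_into_rtrancl)
    then show ?thesis
      using eq face_rel_iff V v by blast
  qed
  then show ?thesis
    by (auto simp: incoming_edges_def)
qed

lemma stratification_iff_face_rel_eq: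
  "stratification P (O_minus P l ` vertices P) \<longleftrightarrow> face_rel P l = chain_rel P l"
  using stratification_imp_face_rel_eq face_rel_eq_imp_incoming stratification_iff_incoming
  by blast

section \<open>Order and grading\<close>

lemma partial_order_chain_rel: "partial_order_on (vertices P) (chain_rel P l)"
proof -
  have "antisym (chain_rel P l)"
    by (rule antisymI) (auto simp: chain_rel_def dest!: chain_less)
  moreover have "trans (chain_rel P l)"
    by (auto simp: trans_def chain_rel_def)
  ultimately show ?thesis
    by (auto simp: partial_order_on_def preorder_on_def refl_on_def chain_rel_def)
qed

lemma directed_edges_subset_face_rel: "directed_edges P l \<subseteq> face_rel P l"
proof clarify
  fix v w assume vw: "(v, w) \<in> directed_edges P l"
  have "closed_segment v w face_of P"
    using vw by (simp add: directed_edges_def edge_of_def)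
  moreover have "min_at l (closed_segment v w) v"
    using generic_polytope.directed_edge_max_at[OF generic_polytope_uminus, of w v] vw
    by (simp add: directed_edges_uminus min_at_uminus closed_segment_commute)
  ultimately show "(v, w) \<in> face_rel P l"
    using face_rel_min_max directed_edge_max_at[OF vw] by blast
qed

lemma refl_face_rel: "v \<in> vertices P \<Longrightarrow> (v, v) \<in> face_rel P l"
  using vertex_face by (auto simp: face_rel_def min_at_def max_at_def)

text \<open>\<open>face_rel P l\<close> is reflexive on vertices and lies between the directed edges
  and \<open>chain_rel P l\<close>, so transitivity is all that separates it from the
  latter.\<close>

lemma face_rel_eq_iff_trans: "face_rel P l = chain_rel P l \<longleftrightarrow> trans (face_rel P l)"
proof
  assume tr: "trans (face_rel P l)"
  have "chain_rel P l \<subseteq> face_rel P l"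
  proof clarify
    fix v w assume "(v, w) \<in> chain_rel P l"
    then have vw: "(v, w) \<in> (directed_edges P l)\<^sup>*" and v: "v \<in> vertices P"
      by (auto simp: chain_rel_def)
    show "(v, w) \<in> face_rel P l"
      using vw
    proof induction
      case base
      then show ?case
        using v refl_face_rel by blast
    next
      case (step x y)
      then show ?case
        using directed_edges_subset_face_rel tr by (meson subsetD transD)
    qed
  qed
  then show "face_rel P l = chain_rel P l"
    using face_rel_subset_chain_rel by blast
next
  assume "face_rel P l = chain_rel P l"
  then show "trans (face_rel P l)"
    by (auto simp: trans_def chain_rel_def)
qed

lemma face_rel_eq_iff_partial_order:
  "face_rel P l = chain_rel P l \<longleftrightarrow> partial_order_on (vertices P) (face_rel P l)"
  using face_rel_eq_iff_trans partial_order_chain_rel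
  by (auto simp: partial_order_on_def preorder_on_def)

text \<open>If \<open>w\<close> covers \<open>v\<close>, then \<open>v \<rightarrow> w\<close> is the only edge of \<open>F\<^sup>-(w)\<close> leaving \<open>F\<^sup>-(v)\<close> from \<open>v\<close>, so
  \<open>F\<^sup>-(w)\<close> lies in the affine span of \<open>F\<^sup>-(v)\<close> and \<open>w\<close>.\<close>

lemma aff_dim_F_minus_cover:
  assumes strat: "stratification P (O_minus P l ` vertices P)"
    and v: "v \<in> vertices P" and w: "w \<in> vertices P"
    and cov: "covered_by (face_rel P l) v w"
  shows "aff_dim (F_minus P l w) = aff_dim (F_minus P l v) + 1"
proof -
  have rel: "(x, y) \<in> face_rel P l \<longleftrightarrow> x \<in> F_minus P l y"
    if "x \<in> vertices P" "y \<in> vertices P" for x y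
    using that strat stratification_chain_rel_iff stratification_imp_face_rel_eq by blast
  have "v \<noteq> w" and vw: "v \<in> F_minus P l w"
    using cov rel v w by (auto simp: covered_by_def)
  have sub: "F_minus P l v \<subseteq> F_minus P l w"
    using strat v w vw by (simp add: stratification_iff_F_minus_mono)
  \<comment> \<open>Faces with different maxima differ, and a proper face has smaller dimension:
    this gives one inequality.\<close>
  have "F_minus P l v \<noteq> F_minus P l w"
    using max_at_unique[OF F_minus_face[OF v] max_at_F_minus[OF v]] max_at_F_minus[OF w] \<open>v \<noteq> w\<close>
    by metis
  moreover have "F_minus P l v face_of F_minus P l w"
    using F_minus_face v w sub face_of_face by blast
  ultimately have less: "aff_dim (F_minus P l v) < aff_dim (F_minus P l w)"
    using face_of_aff_dim_lt face_closed_convex F_minus_face w by blast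
  define A where "A = affine hull (insert w (F_minus P l v))"
  have "F_minus P l w \<subseteq> A"
  proof (rule polytope_subset_affine)
    show "polytope (F_minus P l w)"
      using face_polytope F_minus_face w by blast
    show "v extreme_point_of F_minus P l w"
      using v vw extreme_point_of_face F_minus_face[OF w] by (auto simp: vertices_def)
    show "affine A"
      by (simp add: A_def)
    show "v \<in> A"
      unfolding A_def using mem_F_minus[OF v] by (auto intro: hull_inc)
    fix u assume u: "closed_segment v u edge_of F_minus P l w"
    note edge = directed_edge_in_face[OF F_minus_face[OF w] v vw u]
    from edge(4) show "u \<in> A"
    proof
      assume vu: "(v, u) \<in> directed_edges P l"
      then have "(v, u) \<in> face_rel P l" "v \<noteq> u"
        using directed_edges_subset_face_rel by (auto simp: directed_edges_def)
      moreover have "(u, w) \<in> face_rel P l"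
        using rel edge w by blast
      ultimately have "u = w"
        using cov unfolding covered_by_def by metis
      then show ?thesis
        by (simp add: A_def hull_inc)
    next
      assume "(u, v) \<in> directed_edges P l"
      then have "u \<in> F_minus P l v"
        using directed_edge_subset_F_minus by auto
      then show ?thesis
        by (simp add: A_def hull_inc)
    qed
  qed
  then have "aff_dim (F_minus P l w) \<le> aff_dim A"
    by (rule aff_dim_subset)
  also have "\<dots> \<le> aff_dim (F_minus P l v) + 1"
    unfolding A_def aff_dim_affine_hull aff_dim_insert by simp
  finally show ?thesis
    using less by linarith
qed

lemma stratification_iff_partial_order:
  "stratification P (O_minus P l ` vertices P) \<longleftrightarrow> partial_order_on (vertices P) (face_rel P l)"
  using stratification_iff_face_rel_eq face_rel_eq_iff_partial_order by simp

lemma stratification_iff_graded: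
  "stratification P (O_minus P l ` vertices P) \<longleftrightarrow>
     graded_poset_on (vertices P) (face_rel P l) (\<lambda>v. aff_dim (F_minus P l v))"
  using stratification_iff_partial_order aff_dim_F_minus_cover
  by (auto simp: graded_poset_on_def)

section \<open>Closures of intersections of cells\<close>

text \<open>If the intersection \<open>G\<close> of the two faces is nonempty, then \<open>v\<close>
  and \<open>w\<close> are its minimum and maximum, so its relative interior, which is dense in it,
  lies in both cells.\<close>

lemma stratification_imp_closure_Int:
  assumes strat: "stratification P (O_minus P l ` vertices P)"
    and v: "v \<in> vertices P" and w: "w \<in> vertices P"
  shows "closure (O_plus P l v \<inter> O_minus P l w) = F_plus P l v \<inter> F_minus P l w"
proof
  show "closure (O_plus P l v \<inter> O_minus P l w) \<subseteq> F_plus P l v \<inter> F_minus P l w"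
    unfolding F_plus_def F_minus_def by (simp add: closure_mono)
  define G where "G = F_plus P l v \<inter> F_minus P l w"
  have G: "G face_of P"
    unfolding G_def using v w F_minus_face F_plus_face by (intro face_of_Int) auto
  have "G \<subseteq> closure (O_plus P l v \<inter> O_minus P l w)"
  proof (cases "G = {}")
    case False
    interpret neg: generic_polytope_faces P "\<lambda>x. - l x"
      by (rule generic_polytope_faces_uminus)
    \<comment> \<open>Any vertex of \<open>G\<close> would serve: chains from \<open>v\<close> to
      \<open>a\<close> and from \<open>a\<close> to \<open>w\<close> join to one from
      \<open>v\<close> to \<open>w\<close>.\<close>
    obtain a where a: "a \<in> vertices P" "min_at l G a"
      using neg.max_at_exists[OF G False] by (auto simp: min_at_uminus)
    have eq: "face_rel P l = chain_rel P l"
      using strat by (rule stratification_imp_face_rel_eq)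
    have "a \<in> F_plus P l v" "a \<in> F_minus P l w"
      using a by (auto simp: min_at_def G_def)
    then have "(a, w) \<in> chain_rel P l" "(v, a) \<in> chain_rel P l"
      using chain_to_max[OF F_minus_face[OF w] max_at_F_minus[OF w] a(1)]
        neg.chain_to_max[OF neg.F_minus_face[OF v] neg.max_at_F_minus[OF v] a(1)] a v w
      by (auto simp: chain_rel_def F_plus_uminus directed_edges_uminus rtrancl_converse)
    then have "(v, w) \<in> face_rel P l"
      using eq partial_order_chain_rel
      by (auto simp: partial_order_on_def preorder_on_def elim: transE)
    then have "v \<in> F_minus P l w" "w \<in> F_plus P l v"
      using face_rel_iff v w by auto
    then have "min_at l G v" "max_at l G w"
      using min_at_F_plus[OF v] max_at_F_minus[OF w] by (auto simp: G_def min_at_def max_at_def)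
    then have "rel_interior G \<subseteq> O_plus P l v \<inter> O_minus P l w"
      using G by (auto simp: O_plus_def O_minus_def)
    then have "closure (rel_interior G) \<subseteq> closure (O_plus P l v \<inter> O_minus P l w)"
      by (rule closure_mono)
    then show ?thesis
      using face_closed_convex[OF G] by (simp add: convex_closure_rel_interior)
  qed simp
  then show "F_plus P l v \<inter> F_minus P l w \<subseteq> closure (O_plus P l v \<inter> O_minus P l w)"
    by (simp add: G_def)
qed

text \<open>The middle vertex \<open>u\<close> lies in both closed faces, so the two cells meet. A
  common point lies in the relative interior of a single face, whose minimum is \<open>v\<close> and
  maximum is \<open>w\<close>.\<close>

lemma closure_Int_imp_trans:
  assumes cl: "\<And>v w. v \<in> vertices P \<Longrightarrow> w \<in> vertices P \<Longrightarrow>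
      closure (O_plus P l v \<inter> O_minus P l w) = F_plus P l v \<inter> F_minus P l w"
  shows "trans (face_rel P l)"
proof (rule transI)
  fix v u w assume vu: "(v, u) \<in> face_rel P l" and uw: "(u, w) \<in> face_rel P l"
  then have V: "v \<in> vertices P" "u \<in> vertices P" "w \<in> vertices P"
    by (auto simp: face_rel_def)
  then have "u \<in> F_plus P l v \<inter> F_minus P l w"
    using face_rel_iff vu uw by blast
  then have "O_plus P l v \<inter> O_minus P l w \<noteq> {}"
    using cl V by force
  then obtain x G G' where "x \<in> rel_interior G" "G face_of P" "min_at l G v"
    "x \<in> rel_interior G'" "G' face_of P" "max_at l G' w"
    by (auto simp: O_plus_def O_minus_def)
  then show "(v, w) \<in> face_rel P l"
    using face_of_eq[of G P G'] face_rel_min_max by blast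
qed

lemma stratification_iff_closure_Int:
  "stratification P (O_minus P l ` vertices P) \<longleftrightarrow>
     (\<forall>v\<in>vertices P. \<forall>w\<in>vertices P.
        closure (O_plus P l v \<inter> O_minus P l w) = F_plus P l v \<inter> F_minus P l w)"
  using stratification_imp_closure_Int closure_Int_imp_trans face_rel_eq_iff_trans
    stratification_iff_face_rel_eq by blast

text \<open>Negating \<open>l\<close> replaces both relations by their converses, so their equality
  is unaffected.\<close>

lemma stratification_plus_iff:
  "stratification P (O_plus P l ` vertices P) \<longleftrightarrow> face_rel P l = chain_rel P l"
  using generic_polytope_faces.stratification_iff_face_rel_eq[OF generic_polytope_faces_uminus]
  by (simp add: face_rel_uminus chain_rel_uminus flip: O_plus_uminus)

lemma stratification_plus_iff_outgoing:
  "stratification P (O_plus P l ` vertices P) \<longleftrightarrow>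
     (\<forall>v\<in>vertices P. outgoing_edges P l (F_plus P l v) = {})"
proof -
  have "r\<inverse> = {} \<longleftrightarrow> r = {}" for r :: "'a rel"
    by auto
  then show ?thesis
    using generic_polytope_faces.stratification_iff_incoming[OF generic_polytope_faces_uminus]
    by (simp add: outgoing_edges_uminus O_plus_uminus F_plus_uminus)
qed

end

theorem theorem2p33:
  fixes P :: "(real ^ 'n) set" and l :: "real ^ 'n \<Rightarrow> real"
  assumes "polytope P"
    and "linear l"
    and "\<And>e. e edge_of P \<Longrightarrow> \<not> l constant_on e"
    and "\<And>v. v \<in> vertices P \<Longrightarrow> F_minus P l v face_of P \<and> F_plus P l v face_of P"
  shows
    "(stratification P (O_minus P l ` vertices P) \<longleftrightarrow>
        stratification P (O_plus P l ` vertices P)) \<and>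
     (stratification P (O_minus P l ` vertices P) \<longleftrightarrow>
        (\<forall>v\<in>vertices P. incoming_edges P l (F_minus P l v) = {})) \<and>
     (stratification P (O_minus P l ` vertices P) \<longleftrightarrow>
        (\<forall>v\<in>vertices P. outgoing_edges P l (F_plus P l v) = {})) \<and>
     (stratification P (O_minus P l ` vertices P) \<longleftrightarrow>
        face_rel P l = chain_rel P l) \<and>
     (stratification P (O_minus P l ` vertices P) \<longleftrightarrow>
        partial_order_on (vertices P) (face_rel P l)) \<and>
     (stratification P (O_minus P l ` vertices P) \<longleftrightarrow>
        graded_poset_on (vertices P) (face_rel P l) (\<lambda>v. aff_dim (F_minus P l v))) \<and>
     (stratification P (O_minus P l ` vertices P) \<longleftrightarrow>
        (\<forall>v\<in>vertices P. \<forall>w\<in>vertices P.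
           closure (O_plus P l v \<inter> O_minus P l w) = F_plus P l v \<inter> F_minus P l w))"
proof -
  interpret generic_polytope_faces P l
    using assms by (simp add: generic_polytope_faces_def generic_polytope_faces_axioms_def
        generic_polytope_def)
  show ?thesis
    using stratification_plus_iff stratification_iff_incoming stratification_plus_iff_outgoing
      stratification_iff_face_rel_eq stratification_iff_partial_order stratification_iff_graded
      stratification_iff_closure_Int
    by (intro conjI) simp_all
qed

end
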